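(* Let $X$ be a complex reflexive Banach space, let $Y$ be a complex Banach space, and let $T,A\in\mathcal{K}(X,Y)$. Suppose that $M_T$ is connected. Then $T\perp_B A$ if and only if for each $\gamma\in\mathbb{T}$ there exists $x\in M_T$ such that $Tx\perp_\gamma Ax$.
   Context: $\mathbb{T}$ is the set of complex numbers of modulus one. $\mathcal{K}(X,Y)$ is the space of compact linear operators from $X$ to $Y$ with the operator norm. $M_T:=\{x\in S_X\colon\|Tx\|=\|T\|\}$ is the norm attainment set of $T$, where $S_X$ is the unit sphere of $X$. $x\perp_B y$ (Birkhoff-James orthogonality) means $\|x+\lambda y\|\geq\|x\|$ for all $\lambda\in\mathbb{C}$; for $\gamma\in\mathbb{T}$, $x\perp_\gamma y$ means $\|x+t\gamma y\|\geq\|x\|$ for all $t\in\mathbb{R}$. *)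

theory Defs
  imports "HOL-Analysis.Analysis"
begin

section \<open>Complex normed spaces\<close>

text \<open>A complex normed space is a real normed space (by restriction of scalars) with a
  compatible complex scalar multiplication.  Building on the library class makes its topology,
  completeness and operator norms available.\<close>

class complex_normed_vector = real_normed_vector +
  fixes scaleC :: "complex \<Rightarrow> 'a \<Rightarrow> 'a"  (infixr \<open>*\<^sub>C\<close> 75)
  assumes scaleC_add_right: "a *\<^sub>C (x + y) = a *\<^sub>C x + a *\<^sub>C y"
    and scaleC_add_left: "(a + b) *\<^sub>C x = a *\<^sub>C x + b *\<^sub>C x"
    and scaleC_scaleC: "a *\<^sub>C b *\<^sub>C x = (a * b) *\<^sub>C x"
    and scaleC_of_real: "complex_of_real r *\<^sub>C x = r *\<^sub>R x"
    and norm_scaleC: "norm (a *\<^sub>C x) = cmod a * norm x"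

class complex_banach = complex_normed_vector + complete_space

subclass (in complex_banach) banach ..

instantiation complex :: complex_normed_vector
begin

definition scaleC_complex :: "complex \<Rightarrow> complex \<Rightarrow> complex" where
  "scaleC_complex a x = a * x"

instance
  by standard (simp_all add: scaleC_complex_def algebra_simps norm_mult scaleR_conv_of_real)

end

instance complex :: complex_banach ..

lemma scaleC_one [simp]: "1 *\<^sub>C (x :: 'a :: complex_normed_vector) = x"
  using scaleC_of_real[of 1 x] by simp

lemma bounded_linear_scaleC_right:
  "bounded_linear (\<lambda>x :: 'a :: complex_normed_vector. a *\<^sub>C x)"
proof (rule bounded_linear_intro[where K = "cmod a"])
  fix r :: real and x :: 'a
  show "a *\<^sub>C r *\<^sub>R x = r *\<^sub>R a *\<^sub>C x"
    by (simp only: scaleC_of_real[symmetric] scaleC_scaleC mult.commute)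
qed (simp_all add: scaleC_add_right norm_scaleC mult.commute)

lemmas scaleC_zero_right = linear_0[OF bounded_linear.linear[OF bounded_linear_scaleC_right]]
  and scaleC_minus_right = linear_neg[OF bounded_linear.linear[OF bounded_linear_scaleC_right]]
  and scaleC_diff_right = linear_diff[OF bounded_linear.linear[OF bounded_linear_scaleC_right]]


section \<open>Bounded complex-linear operators\<close>

typedef (overloaded) ('a, 'b) cblinfun (\<open>(_ \<Rightarrow>\<^sub>C\<^sub>L /_)\<close> [22, 21] 21) =
  "{f :: 'a :: complex_normed_vector \<Rightarrow> 'b :: complex_normed_vector.
      bounded_linear f \<and> (\<forall>a x. f (a *\<^sub>C x) = a *\<^sub>C f x)}"
  morphisms cblinfun_apply CBlinfun
proof
  show "(\<lambda>_. 0) \<in> {f :: 'a \<Rightarrow> 'b. bounded_linear f \<and> (\<forall>a x. f (a *\<^sub>C x) = a *\<^sub>C f x)}"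
    by (auto simp: bounded_linear_zero scaleC_zero_right)
qed

declare [[coercion
    "cblinfun_apply :: ('a::complex_normed_vector \<Rightarrow>\<^sub>C\<^sub>L 'b::complex_normed_vector) \<Rightarrow> 'a \<Rightarrow> 'b"]]

setup_lifting type_definition_cblinfun

instantiation cblinfun :: (complex_normed_vector, complex_normed_vector) complex_normed_vector
begin

lift_definition norm_cblinfun :: "('a \<Rightarrow>\<^sub>C\<^sub>L 'b) \<Rightarrow> real" is onorm .

lift_definition zero_cblinfun :: "'a \<Rightarrow>\<^sub>C\<^sub>L 'b" is "\<lambda>x. 0"
  by (auto simp: bounded_linear_zero scaleC_zero_right)

lift_definition plus_cblinfun :: "('a \<Rightarrow>\<^sub>C\<^sub>L 'b) \<Rightarrow> ('a \<Rightarrow>\<^sub>C\<^sub>L 'b) \<Rightarrow> ('a \<Rightarrow>\<^sub>C\<^sub>L 'b)"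
  is "\<lambda>f g x. f x + g x"
  by (simp add: bounded_linear_add scaleC_add_right)

lift_definition uminus_cblinfun :: "('a \<Rightarrow>\<^sub>C\<^sub>L 'b) \<Rightarrow> ('a \<Rightarrow>\<^sub>C\<^sub>L 'b)" is "\<lambda>f x. - f x"
  by (simp add: bounded_linear_minus scaleC_minus_right)

lift_definition minus_cblinfun :: "('a \<Rightarrow>\<^sub>C\<^sub>L 'b) \<Rightarrow> ('a \<Rightarrow>\<^sub>C\<^sub>L 'b) \<Rightarrow> ('a \<Rightarrow>\<^sub>C\<^sub>L 'b)"
  is "\<lambda>f g x. f x - g x"
  by (simp add: bounded_linear_sub scaleC_diff_right)

lift_definition scaleC_cblinfun :: "complex \<Rightarrow> ('a \<Rightarrow>\<^sub>C\<^sub>L 'b) \<Rightarrow> ('a \<Rightarrow>\<^sub>C\<^sub>L 'b)"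
  is "\<lambda>a f x. a *\<^sub>C f x"
  by (auto simp: scaleC_scaleC mult.commute
      intro: bounded_linear_compose[OF bounded_linear_scaleC_right])

definition scaleR_cblinfun :: "real \<Rightarrow> ('a \<Rightarrow>\<^sub>C\<^sub>L 'b) \<Rightarrow> ('a \<Rightarrow>\<^sub>C\<^sub>L 'b)" where
  "scaleR_cblinfun r f = complex_of_real r *\<^sub>C f"

definition dist_cblinfun :: "('a \<Rightarrow>\<^sub>C\<^sub>L 'b) \<Rightarrow> ('a \<Rightarrow>\<^sub>C\<^sub>L 'b) \<Rightarrow> real" where
  "dist_cblinfun f g = norm (f - g)"

definition sgn_cblinfun :: "('a \<Rightarrow>\<^sub>C\<^sub>L 'b) \<Rightarrow> ('a \<Rightarrow>\<^sub>C\<^sub>L 'b)" where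
  "sgn_cblinfun f = inverse (norm f) *\<^sub>R f"

definition uniformity_cblinfun :: "(('a \<Rightarrow>\<^sub>C\<^sub>L 'b) \<times> ('a \<Rightarrow>\<^sub>C\<^sub>L 'b)) filter" where
  "uniformity_cblinfun = (INF e\<in>{0 <..}. principal {(f, g). dist f g < e})"

definition open_cblinfun :: "('a \<Rightarrow>\<^sub>C\<^sub>L 'b) set \<Rightarrow> bool" where
  "open_cblinfun S = (\<forall>f\<in>S. \<forall>\<^sub>F (f', g) in uniformity. f' = f \<longrightarrow> g \<in> S)"

instance
proof
  fix a b :: complex and r s :: real and f g h :: "'a \<Rightarrow>\<^sub>C\<^sub>L 'b" and S :: "('a \<Rightarrow>\<^sub>C\<^sub>L 'b) set"
  show "f + g + h = f + (g + h)" "f + g = g + f" "0 + f = f" "- f + f = 0" "f - g = f + - g"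
    by (transfer, simp add: algebra_simps)+
  show "r *\<^sub>R (f + g) = r *\<^sub>R f + r *\<^sub>R g" "(r + s) *\<^sub>R f = r *\<^sub>R f + s *\<^sub>R f"
    "r *\<^sub>R s *\<^sub>R f = (r * s) *\<^sub>R f" "1 *\<^sub>R f = f"
    unfolding scaleR_cblinfun_def
    by (transfer, simp add: scaleC_add_left scaleC_add_right scaleC_scaleC)+
  show "a *\<^sub>C (f + g) = a *\<^sub>C f + a *\<^sub>C g" "(a + b) *\<^sub>C f = a *\<^sub>C f + b *\<^sub>C f"
    "a *\<^sub>C b *\<^sub>C f = (a * b) *\<^sub>C f"
    by (transfer, simp add: scaleC_add_left scaleC_add_right scaleC_scaleC)+
  show "complex_of_real r *\<^sub>C f = r *\<^sub>R f"
    by (simp only: scaleR_cblinfun_def)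
  show "norm f = 0 \<longleftrightarrow> f = 0"
    by transfer (auto simp: onorm_eq_0)
  show "norm (f + g) \<le> norm f + norm g"
    by transfer (simp add: onorm_triangle)
  show "norm (r *\<^sub>R f) = \<bar>r\<bar> * norm f"
    unfolding scaleR_cblinfun_def by transfer (simp add: scaleC_of_real onorm_scaleR)
  show "norm (a *\<^sub>C f) = cmod a * norm f"
  proof transfer
    fix a :: complex and f :: "'a \<Rightarrow> 'b"
    have "onorm (\<lambda>x. a *\<^sub>C f x) = onorm (\<lambda>x. cmod a *\<^sub>R f x)"
      by (simp add: onorm_def norm_scaleC)
    moreover assume "bounded_linear f \<and> (\<forall>a x. f (a *\<^sub>C x) = a *\<^sub>C f x)"
    ultimately show "onorm (\<lambda>x. a *\<^sub>C f x) = cmod a * onorm f"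
      by (simp add: onorm_scaleR)
  qed
qed (simp_all only: dist_cblinfun_def sgn_cblinfun_def uniformity_cblinfun_def open_cblinfun_def)

end

lemma bounded_linear_cblinfun_apply: "bounded_linear (cblinfun_apply f)"
  using cblinfun_apply[of f] by simp

lemma scaleR_cblinfun_apply: "cblinfun_apply (r *\<^sub>R f) x = r *\<^sub>R cblinfun_apply f x"
  by (metis scaleC_cblinfun.rep_eq scaleC_of_real)

lemma norm_cblinfun: "norm (cblinfun_apply f x) \<le> norm f * norm x"
  by transfer (simp add: onorm)

text \<open>The space \<open>\<K>(X, Y)\<close>, as a subset of the space of all bounded operators with the
  operator norm.\<close>

definition compact_operators ::
    "('a :: complex_normed_vector \<Rightarrow>\<^sub>C\<^sub>L 'b :: complex_normed_vector) set" where
  "compact_operators = {T. compact (closure (cblinfun_apply T ` cball 0 1))}"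

definition norm_attainment_set ::
    "('a :: complex_normed_vector \<Rightarrow>\<^sub>C\<^sub>L 'b :: complex_normed_vector) \<Rightarrow> 'a set" where
  "norm_attainment_set T = {x \<in> sphere 0 1. norm (T x) = norm T}"


section \<open>Reflexivity\<close>

type_synonym 'a cdual = "'a \<Rightarrow>\<^sub>C\<^sub>L complex"

lift_definition bidual_embedding :: "'a :: complex_normed_vector \<Rightarrow> 'a cdual cdual"
  is "\<lambda>x f. cblinfun_apply f x"
proof
  fix x :: 'a
  show "bounded_linear (\<lambda>f :: 'a cdual. f x)"
    by (rule bounded_linear_intro[where K = "norm x"])
      (simp_all add: plus_cblinfun.rep_eq scaleR_cblinfun_apply norm_cblinfun)
qed (simp add: scaleC_cblinfun.rep_eq)

definition reflexive_space :: "'a :: complex_normed_vector itself \<Rightarrow> bool" where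
  "reflexive_space _ \<longleftrightarrow> surj (bidual_embedding :: 'a \<Rightarrow> 'a cdual cdual)"


section \<open>Birkhoff--James orthogonality\<close>

definition bj_orthogonal :: "'a :: complex_normed_vector \<Rightarrow> 'a \<Rightarrow> bool"
    (infix \<open>\<bottom>\<^sub>B\<close> 50) where
  "x \<bottom>\<^sub>B y \<longleftrightarrow> (\<forall>c :: complex. norm (x + c *\<^sub>C y) \<ge> norm x)"

definition bj_orthogonal_dir :: "complex \<Rightarrow> 'a :: complex_normed_vector \<Rightarrow> 'a \<Rightarrow> bool" where
  "bj_orthogonal_dir \<gamma> x y \<longleftrightarrow> (\<forall>t :: real. norm (x + (complex_of_real t * \<gamma>) *\<^sub>C y) \<ge> norm x)"

end

theory Submission
  imports Defs
begin

text \<open>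
  For a direction \<open>\<gamma>\<close>, let \<open>P\<^sub>\<gamma>\<close> be the closed set of those \<open>x\<close> for which
  \<open>\<parallel>T x + t \<gamma> A x\<parallel> \<ge> \<parallel>T x\<parallel>\<close> whenever \<open>t \<ge> 0\<close>. Convexity of \<open>t \<mapsto> \<parallel>T x + t \<gamma> A x\<parallel>\<close> shows that
  \<open>P\<^sub>\<gamma>\<close> and the set for the direction \<open>- \<gamma>\<close> cover the whole space, so if both meet the connected
  set \<open>M\<^sub>T\<close>, they have a common point in it. That \<open>P\<^sub>\<gamma>\<close> meets \<open>M\<^sub>T\<close> follows by choosing \<open>x\<^sub>n\<close> in the
  unit ball that almost attain the norm of \<open>T + (1/n) \<gamma> A\<close>; by compactness \<open>(T x\<^sub>n, A x\<^sub>n)\<close>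
  subconverges, and by reflexivity the limit is of the form \<open>(T x, A x)\<close> with \<open>\<parallel>x\<parallel> \<le> 1\<close>.

  The last step avoids weak topologies: the functional \<open>g \<circ> T + h \<circ> A \<mapsto> g y + h z\<close> on a subspace of
  the dual is bounded by the norm when \<open>(y, z)\<close> is the limit above; a Hahn--Banach extension of it
  belongs to the bidual, hence is evaluation at the required \<open>x\<close>.
\<close>

section \<open>The Hahn--Banach theorem\<close>

definition sublinear :: "('a :: real_vector \<Rightarrow> real) \<Rightarrow> bool" where
  "sublinear p \<longleftrightarrow> (\<forall>x y. p (x + y) \<le> p x + p y) \<and> (\<forall>r\<ge>0. \<forall>x. p (r *\<^sub>R x) \<le> r * p x)"

lemma sublinear_add: "sublinear p \<Longrightarrow> p (x + y) \<le> p x + p y"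
  and sublinear_scaleR_le: "sublinear p \<Longrightarrow> r \<ge> 0 \<Longrightarrow> p (r *\<^sub>R x) \<le> r * p x"
  by (auto simp: sublinear_def)

lemma sublinear_zero: "sublinear p \<Longrightarrow> p 0 = 0"
  using sublinear_add[of p 0 0] sublinear_scaleR_le[of p 0 0] by simp

text \<open>\<open>sublinear\<close> assumes homogeneity only as an inequality, which infima inherit
  directly; applying it to the factor \<open>inverse r\<close> yields the reverse inequality for
  positive \<open>r\<close>.\<close>

lemma sublinear_scaleR:
  assumes "sublinear p" "r \<ge> 0"
  shows "p (r *\<^sub>R x) = r * p x"
proof (cases "r = 0")
  case False
  with assms have r: "r > 0" by simp
  have "p x \<le> inverse r * p (r *\<^sub>R x)"
    using sublinear_scaleR_le[OF assms(1), of "inverse r" "r *\<^sub>R x"] r by simp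
  then have "r * p x \<le> p (r *\<^sub>R x)"
    using r by (simp add: field_simps)
  then show ?thesis
    using sublinear_scaleR_le[OF assms] by (simp add: antisym)
qed (simp add: sublinear_zero[OF assms(1)])

lemma sublinear_minus: "sublinear p \<Longrightarrow> - p (- x) \<le> p x"
  using sublinear_add[of p x "- x"] sublinear_zero[of p] by simp

lemma sublinear_norm: "sublinear norm"
  by (auto simp: sublinear_def norm_triangle_ineq)

text \<open>Serves infima over a chain, along a ray and over the domain of a linear map. The bound
  \<open>b\<close> keeps the infima finite; the free index \<open>k\<close> lets a chain choose its
  smaller member and lets indices add and scale in the other two families.\<close>

lemma sublinear_INF:
  fixes F :: "'i \<Rightarrow> 'a :: real_vector \<Rightarrow> real"
  assumes ne: "I \<noteq> {}"
    and lower: "\<And>i x. i \<in> I \<Longrightarrow> b x \<le> F i x"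
    and add: "\<And>i j x y. i \<in> I \<Longrightarrow> j \<in> I \<Longrightarrow> \<exists>k\<in>I. F k (x + y) \<le> F i x + F j y"
    and scale: "\<And>i r x. i \<in> I \<Longrightarrow> r \<ge> 0 \<Longrightarrow> \<exists>k\<in>I. F k (r *\<^sub>R x) \<le> r * F i x"
  shows "sublinear (\<lambda>x. INF i\<in>I. F i x)"
proof -
  have le: "(INF i\<in>I. F i x) \<le> F i x" if "i \<in> I" for i x
    using lower that by (intro cINF_lower bdd_belowI2[where m = "b x"])
  have "(INF i\<in>I. F i (x + y)) \<le> (INF i\<in>I. F i x) + (INF i\<in>I. F i y)" for x y
  proof -
    have *: "(INF i\<in>I. F i (x + y)) \<le> F i x + F j y" if "i \<in> I" "j \<in> I" for i j
      using add[OF that, of x y] le[of _ "x + y"] by force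
    \<comment> \<open>The infimum is taken over the second index with \<open>i\<close> fixed, then
      over \<open>i\<close>.\<close>
    have "(INF i\<in>I. F i (x + y)) - F i x \<le> (INF i\<in>I. F i y)" if "i \<in> I" for i
      using *[OF that] by (intro cINF_greatest[OF ne]) (simp only: diff_le_eq add.commute)
    then have "(INF i\<in>I. F i (x + y)) - (INF i\<in>I. F i y) \<le> (INF i\<in>I. F i x)"
      by (intro cINF_greatest[OF ne]) (simp add: algebra_simps)
    then show ?thesis by simp
  qed
  moreover have "(INF i\<in>I. F i (r *\<^sub>R x)) \<le> r * (INF i\<in>I. F i x)" if r: "r \<ge> 0" for r x
  proof -
    have *: "(INF i\<in>I. F i (r *\<^sub>R x)) \<le> r * F i x" if "i \<in> I" for i
      using scale[OF that r, of x] le[of _ "r *\<^sub>R x"] by force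
    show ?thesis
    proof (cases "r = 0")
      case True
      then show ?thesis using * ne by auto
    next
      case False
      with r have "r > 0" by simp
      then have "(INF i\<in>I. F i (r *\<^sub>R x)) / r \<le> (INF i\<in>I. F i x)"
        using * by (intro cINF_greatest[OF ne]) (simp add: field_simps)
      then show ?thesis using \<open>r > 0\<close> by (simp add: field_simps)
    qed
  qed
  ultimately show ?thesis by (simp add: sublinear_def)
qed

section \<open>Minimal sublinear functionals\<close>

lemma minimal_sublinear_exists:
  fixes p :: "'a :: real_vector \<Rightarrow> real"
  assumes p: "sublinear p"
  obtains q where "sublinear q" "q \<le> p" "\<And>q'. sublinear q' \<Longrightarrow> q' \<le> q \<Longrightarrow> q' = q"
proof -
  define S where "S = {q. sublinear q \<and> q \<le> p}"
  \<comment> \<open>The order is reversed, so the maximal element from Zorn's lemma is a pointwise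
    minimal functional.\<close>
  have "\<exists>m\<in>S. \<forall>q\<in>S. q \<le> m \<longrightarrow> q = m"
  proof (rule predicate_Zorn)
    show "partial_order_on S (relation_of (\<lambda>q q'. q' \<le> q) S)"
      by (auto simp: partial_order_on_def preorder_on_def refl_on_def trans_def antisym_def
          relation_of_def)
  next
    fix C assume C: "C \<in> Chains (relation_of (\<lambda>q q'. q' \<le> q) S)"
    then have sub: "C \<subseteq> S" by (auto simp: Chains_def relation_of_def)
    show "\<exists>u\<in>S. \<forall>a\<in>C. u \<le> a"
    proof (cases "C = {}")
      case True
      then show ?thesis using p by (auto simp: S_def)
    next
      case False
      define u where "u x = (INF q\<in>C. q x)" for x
      \<comment> \<open>A bound depending only on \<open>p\<close>, uniform over the chain, so that
        the pointwise infimum \<open>u\<close> is finite.\<close>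
      have lower: "- p (- x) \<le> q x" if "q \<in> C" for q x
      proof -
        have "sublinear q" "q (- x) \<le> p (- x)"
          using that sub by (auto simp: S_def le_fun_def)
        then show ?thesis using sublinear_minus[of q x] by simp
      qed
      have u_le: "u \<le> q" if "q \<in> C" for q
        using lower that by (auto simp: le_fun_def u_def intro!: cINF_lower bdd_belowI2)
      have "sublinear u"
        unfolding u_def
      proof (rule sublinear_INF[OF False lower])
        fix q q' :: "'a \<Rightarrow> real" and x y assume q: "q \<in> C" "q' \<in> C"
        then have "q \<le> q' \<or> q' \<le> q"
          using C by (auto simp: Chains_def relation_of_def)
        moreover have "sublinear q" "sublinear q'"
          using q sub by (auto simp: S_def)
        then have "q (x + y) \<le> q x + q y" "q' (x + y) \<le> q' x + q' y"
          by (simp_all add: sublinear_add)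
        \<comment> \<open>The smaller of \<open>q\<close> and \<open>q'\<close> serves as the common
          index \<open>k\<close>.\<close>
        ultimately have "q (x + y) \<le> q x + q' y \<or> q' (x + y) \<le> q x + q' y"
          by (smt (verit) le_funD)
        then show "\<exists>k\<in>C. k (x + y) \<le> q x + q' y"
          using q by blast
      next
        fix q :: "'a \<Rightarrow> real" and r :: real and x assume "q \<in> C" "r \<ge> 0"
        then show "\<exists>k\<in>C. k (r *\<^sub>R x) \<le> r * q x"
          using sub by (intro bexI[of _ q]) (auto simp: S_def sublinear_scaleR_le)
      qed
      moreover have "u \<le> p"
        using False u_le sub by (auto simp: S_def intro: order_trans)
      ultimately show ?thesis using u_le by (auto simp: S_def)
    qed
  qed
  then obtain q where "q \<in> S" "\<forall>q'\<in>S. q' \<le> q \<longrightarrow> q' = q" by blast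
  then show thesis
    by (intro that[of q]) (auto simp: S_def intro: order_trans)
qed

text \<open>For fixed \<open>y\<close>, pushing \<open>q\<close> down along the ray of
  \<open>y\<close> gives a sublinear functional below \<open>q\<close>, hence \<open>q\<close>
  itself by minimality; this forces superadditivity.\<close>

lemma minimal_sublinear_linear:
  fixes q :: "'a :: real_vector \<Rightarrow> real"
  assumes q: "sublinear q" and minimal: "\<And>q'. sublinear q' \<Longrightarrow> q' \<le> q \<Longrightarrow> q' = q"
  shows "linear q"
proof -
  have add: "q (x + y) = q x + q y" for x y
  proof -
    \<comment> \<open>\<open>t = 0\<close> gives \<open>q' \<le> q\<close>; once
      \<open>q' = q\<close>, \<open>t = 1\<close> gives
      \<open>q x + q y \<le> q (x + y)\<close>.\<close>
    define F where "F t v = q (v + t *\<^sub>R y) - t * q y" for t v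
    define q' where "q' v = (INF t\<in>{0..}. F t v)" for v
    have lower: "- q (- v) \<le> F t v" if "t \<in> {0..}" for t v
      using that sublinear_add[OF q, of "v + t *\<^sub>R y" "- v"] sublinear_scaleR[OF q, of t y]
      by (simp add: F_def)
    have q'_le: "q' v \<le> F t v" if "t \<ge> 0" for t v
      unfolding q'_def using lower that by (intro cINF_lower bdd_belowI2) auto
    have "sublinear q'"
      unfolding q'_def
    proof (rule sublinear_INF[OF _ lower])
      fix s t :: real and v w :: 'a assume st: "s \<in> {0..}" "t \<in> {0..}"
      have "F (s + t) (v + w) \<le> F s v + F t w"
        using sublinear_add[OF q, of "v + s *\<^sub>R y" "w + t *\<^sub>R y"]
        by (simp add: F_def algebra_simps)
      then show "\<exists>k\<in>{0..}. F k (v + w) \<le> F s v + F t w"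
        using st by (intro bexI[of _ "s + t"]) auto
    next
      fix t r :: real and v :: 'a assume t: "t \<in> {0..}" and r: "r \<ge> 0"
      have "F (r * t) (r *\<^sub>R v) \<le> r * F t v"
        using sublinear_scaleR_le[OF q r, of "v + t *\<^sub>R y"]
        by (simp add: F_def algebra_simps)
      then show "\<exists>k\<in>{0..}. F k (r *\<^sub>R v) \<le> r * F t v"
        using t r by (intro bexI[of _ "r * t"]) auto
    qed simp
    moreover have "q' \<le> q"
      using q'_le[of 0] by (simp add: le_fun_def F_def)
    ultimately have "q' = q" by (rule minimal)
    then have "q x \<le> q (x + y) - q y"
      using q'_le[of 1 x] by (simp add: F_def)
    then show ?thesis
      using sublinear_add[OF q, of x y] by simp
  qed
  have minus: "q (- x) = - q x" for x
    using add[of x "- x"] sublinear_zero[OF q] by simp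
  have "q (r *\<^sub>R x) = r * q x" for r x
    using sublinear_scaleR[OF q, of r x] sublinear_scaleR[OF q, of "- r" x] minus[of "r *\<^sub>R x"]
    by (cases "r \<ge> 0") auto
  then show ?thesis by (intro linearI) (simp_all add: add)
qed

text \<open>The subspace is given as the range of \<open>h\<close>, which may have a kernel:
  \<open>le\<close> at \<open>w\<close> and \<open>- w\<close> makes \<open>g\<close> vanish there,
  so \<open>g\<close> induces a functional on the range.\<close>

lemma hahn_banach_sublinear:
  fixes p :: "'a :: real_vector \<Rightarrow> real" and h :: "'w :: real_vector \<Rightarrow> 'a" and g :: "'w \<Rightarrow> real"
  assumes p: "sublinear p" and h: "linear h" and g: "linear g" and le: "\<And>w. g w \<le> p (h w)"
  obtains f where "linear f" "\<And>x. f x \<le> p x" "\<And>w. f (h w) = g w"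
proof -
  \<comment> \<open>\<open>p'\<close> lies below \<open>p\<close> (take \<open>w = 0\<close>) and
    satisfies \<open>p' (h w) \<le> g w\<close>. A linear \<open>f \<le> p'\<close> thus has
    \<open>f (h w) \<le> g w\<close>, and replacing \<open>w\<close> by \<open>- w\<close> gives
    equality.\<close>
  define F where "F w x = p (x - h w) + g w" for w x
  define p' where "p' x = (INF w. F w x)" for x
  have lower: "- p (- x) \<le> F w x" for w x
    using sublinear_add[OF p, of "x - h w" "- x"] le[of "- w"]
    by (simp add: F_def linear_neg[OF h] linear_neg[OF g])
  have p'_le: "p' x \<le> F w x" for w x
    unfolding p'_def using lower by (intro cINF_lower bdd_belowI2) auto
  have "sublinear p'"
    unfolding p'_def
  proof (rule sublinear_INF[OF _ lower])
    fix v w :: 'w and x y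
    have "F (v + w) (x + y) \<le> F v x + F w y"
      using sublinear_add[OF p, of "x - h v" "y - h w"]
      by (simp add: F_def linear_add[OF h] linear_add[OF g] algebra_simps)
    then show "\<exists>k\<in>UNIV. F k (x + y) \<le> F v x + F w y" by blast
  next
    fix w :: 'w and r :: real and x assume r: "r \<ge> 0"
    have "F (r *\<^sub>R w) (r *\<^sub>R x) \<le> r * F w x"
      using sublinear_scaleR_le[OF p r, of "x - h w"]
      by (simp add: F_def linear_scale[OF h] linear_scale[OF g] algebra_simps)
    then show "\<exists>k\<in>UNIV. F k (r *\<^sub>R x) \<le> r * F w x" by blast
  qed simp
  then obtain f where f: "sublinear f" "f \<le> p'" "\<And>q'. sublinear q' \<Longrightarrow> q' \<le> f \<Longrightarrow> q' = f"
    using minimal_sublinear_exists by blast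
  have lin: "linear f" by (rule minimal_sublinear_linear) (use f in auto)
  have f_le: "f x \<le> F w x" for x w
    using f(2) p'_le[of x w] by (force simp: le_fun_def intro: order_trans)
  have "f x \<le> p x" for x
    using f_le[of x 0] by (simp add: F_def linear_0[OF h] linear_0[OF g])
  moreover have "f (h w) = g w" for w
  proof -
    have "f (h w) \<le> g w" for w
      using f_le[of "h w" w] by (simp add: F_def sublinear_zero[OF p])
    from this[of w] this[of "- w"] show ?thesis
      by (simp add: linear_neg[OF h] linear_neg[OF g] linear_neg[OF lin])
  qed
  ultimately show thesis using lin by (intro that)
qed

section \<open>From real to complex functionals\<close>

lemma complex_functional_of_real:
  fixes f :: "'a :: complex_normed_vector \<Rightarrow> real"
  assumes f: "linear f" and le: "\<And>x. f x \<le> norm x"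
  obtains F :: "'a \<Rightarrow>\<^sub>C\<^sub>L complex" where "\<And>x. Re (F x) = f x" "norm F \<le> 1"
proof -
  \<comment> \<open>The only possible form: the imaginary part of a complex linear functional at
    \<open>x\<close> is minus its real part at \<open>\<i> *\<^sub>C x\<close>.\<close>
  define G where "G x = Complex (f x) (- f (\<i> *\<^sub>C x))" for x
  have f_scaleC: "f (a *\<^sub>C x) = Re a * f x + Im a * f (\<i> *\<^sub>C x)" for a x
  proof -
    have "a *\<^sub>C x = Re a *\<^sub>R x + Im a *\<^sub>R \<i> *\<^sub>C x"
      by (subst complex_eq[of a])
        (simp only: scaleC_add_left scaleC_of_real[symmetric] scaleC_scaleC mult.commute)
    then show ?thesis
      by (simp add: linear_add[OF f] linear_scale[OF f])
  qed
  have scale: "G (a *\<^sub>C x) = a * G x" for a x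
    using f_scaleC[of a x] f_scaleC[of "\<i> * a" x]
    by (simp add: G_def complex_eq_iff scaleC_scaleC)
  have bound: "cmod (G x) \<le> norm x" for x
  proof (cases "G x = 0")
    case False
    \<comment> \<open>Rotating \<open>x\<close> by \<open>a\<close> makes the value of
      \<open>G\<close> real and equal to \<open>cmod (G x)\<close>, so the bound on \<open>f\<close>
      passes to \<open>G\<close> without loss.\<close>
    define a where "a = cnj (sgn (G x))"
    have "a * G x = of_real (cmod (G x))"
      using complex_norm_square[of "G x"] False
      by (simp add: a_def sgn_eq field_simps power2_eq_square)
    then have "cmod (G x) = f (a *\<^sub>C x)"
      using scale[of a x] by (metis G_def Re_complex_of_real complex.sel(1))
    also have "\<dots> \<le> norm (a *\<^sub>C x)" by (rule le)
    also have "\<dots> = norm x" using False by (simp add: a_def norm_scaleC norm_sgn)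
    finally show ?thesis .
  qed simp
  have "bounded_linear G"
  proof (rule bounded_linear_intro[where K = 1])
    show "G (x + y) = G x + G y" for x y
      by (simp add: G_def linear_add[OF f] scaleC_add_right complex_eq_iff)
    show "G (r *\<^sub>R x) = r *\<^sub>R G x" for r x
      using scale[of "of_real r" x] by (simp add: scaleC_of_real scaleR_conv_of_real)
  qed (use bound in simp)
  then have G: "cblinfun_apply (CBlinfun G) = G"
    using scale by (intro CBlinfun_inverse) (simp add: scaleC_complex_def)
  show thesis
  proof (rule that[of "CBlinfun G"])
    show "norm (CBlinfun G) \<le> 1"
      unfolding norm_cblinfun.rep_eq G by (rule onorm_bound) (use bound in simp_all)
  qed (simp add: G, simp add: G_def)
qed

lemma hahn_banach_complex:
  fixes h :: "'w :: real_vector \<Rightarrow> 'a :: complex_normed_vector" and g :: "'w \<Rightarrow> real"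
  assumes "linear h" "linear g" "\<And>w. g w \<le> norm (h w)"
  obtains F :: "'a \<Rightarrow>\<^sub>C\<^sub>L complex" where "norm F \<le> 1" "\<And>w. Re (F (h w)) = g w"
proof -
  obtain f where f: "linear f" "\<And>x. f x \<le> norm x" "\<And>w. f (h w) = g w"
    using hahn_banach_sublinear[OF sublinear_norm assms] by blast
  then show thesis
    using complex_functional_of_real[OF f(1,2)] that by metis
qed

text \<open>Extends the functional on the real line through \<open>x\<close> that sends
  \<open>r *\<^sub>R x\<close> to \<open>r * norm x\<close>; the parametrisation by \<open>r\<close>
  includes \<open>x = 0\<close>.\<close>

lemma norming_functional:
  fixes x :: "'a :: complex_normed_vector"
  obtains F :: "'a \<Rightarrow>\<^sub>C\<^sub>L complex" where "norm F \<le> 1" "Re (F x) = norm x"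
proof -
  have "linear (\<lambda>r. r *\<^sub>R x)" "linear (\<lambda>r. r * norm x)"
    by (auto intro!: linearI simp: algebra_simps)
  moreover have "r * norm x \<le> norm (r *\<^sub>R x)" for r
    by (simp add: mult_right_mono)
  ultimately obtain F :: "'a \<Rightarrow>\<^sub>C\<^sub>L complex" where
    "norm F \<le> 1" "\<And>r. Re (F (r *\<^sub>R x)) = r * norm x"
    using hahn_banach_complex[of "\<lambda>r. r *\<^sub>R x" "\<lambda>r. r * norm x"] by metis
  then show thesis using that[of F] by (metis scaleR_one mult_1)
qed

section \<open>Operators on reflexive spaces\<close>

lemmas cblinfun_apply_zero = linear_0[OF bounded_linear.linear[OF bounded_linear_cblinfun_apply]]
  and cblinfun_apply_scaleR = linear_scale[OF bounded_linear.linear[OF bounded_linear_cblinfun_apply]]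
  and cblinfun_apply_diff = linear_diff[OF bounded_linear.linear[OF bounded_linear_cblinfun_apply]]

lift_definition cblinfun_compose ::
  "('b :: complex_normed_vector \<Rightarrow>\<^sub>C\<^sub>L 'c :: complex_normed_vector) \<Rightarrow>
    ('a :: complex_normed_vector \<Rightarrow>\<^sub>C\<^sub>L 'b) \<Rightarrow> ('a \<Rightarrow>\<^sub>C\<^sub>L 'c)"
  is "\<lambda>f g x. f (g x)"
  by (simp add: bounded_linear_compose)

text \<open>Takes the place of weak compactness of the unit ball; handling \<open>T\<close> and
  \<open>A\<close> jointly yields one \<open>x\<close> for both limits.\<close>

lemma reflexive_limit_of_images:
  fixes T :: "'a :: complex_normed_vector \<Rightarrow>\<^sub>C\<^sub>L 'b :: complex_normed_vector"
    and A :: "'a \<Rightarrow>\<^sub>C\<^sub>L 'c :: complex_normed_vector"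
  assumes refl: "reflexive_space TYPE('a)"
    and xs: "\<And>n. norm (xs n) \<le> 1"
    and Ty: "(\<lambda>n. T (xs n)) \<longlonglongrightarrow> y" and Az: "(\<lambda>n. A (xs n)) \<longlonglongrightarrow> z"
  obtains x where "norm x \<le> 1" "T x = y" "A x = z"
proof -
  \<comment> \<open>\<open>h\<close> sums the images of \<open>f\<close> and \<open>g\<close> under
    the adjoints of \<open>T\<close> and \<open>A\<close>, and \<open>l\<close> is the real part of
    evaluation at the pair of limits.\<close>
  define h where "h = (\<lambda>(f :: 'b cdual, g :: 'c cdual). cblinfun_compose f T + cblinfun_compose g A)"
  define l where "l = (\<lambda>(f :: 'b cdual, g :: 'c cdual). Re (f y + g z))"
  have h_apply: "h (f, g) v = f (T v) + g (A v)"
    for f :: "'b cdual" and g :: "'c cdual" and v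
    by (simp add: h_def plus_cblinfun.rep_eq cblinfun_compose.rep_eq)
  have "linear h"
  proof (rule linearI)
    fix v w :: "'b cdual \<times> 'c cdual" and r :: real
    have "h (v + w) u = (h v + h w) u" for u
      by (cases v, cases w) (simp add: h_apply plus_cblinfun.rep_eq)
    then show "h (v + w) = h v + h w"
      by (metis cblinfun_apply_inject ext)
    have "h (r *\<^sub>R v) u = (r *\<^sub>R h v) u" for u
      by (cases v) (simp add: h_apply scaleR_cblinfun_apply scaleR_add_right)
    then show "h (r *\<^sub>R v) = r *\<^sub>R h v"
      by (metis cblinfun_apply_inject ext)
  qed
  moreover have "linear l"
    by (auto intro!: linearI simp: l_def plus_cblinfun.rep_eq scaleR_cblinfun_apply algebra_simps)
  moreover have "l w \<le> norm (h w)" for w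
  proof (cases w)
    case (Pair f g)
    have "(\<lambda>n. Re (h w (xs n))) \<longlonglongrightarrow> l w"
      unfolding Pair h_apply l_def split
      by (intro tendsto_intros bounded_linear.tendsto[OF bounded_linear_cblinfun_apply] Ty Az)
    moreover have "Re (h w (xs n)) \<le> norm (h w)" for n
    proof -
      have "Re (h w (xs n)) \<le> norm (h w) * norm (xs n)"
        by (rule order_trans[OF complex_Re_le_cmod norm_cblinfun])
      also have "\<dots> \<le> norm (h w)"
        using xs[of n] by (simp add: mult_left_le)
      finally show ?thesis .
    qed
    ultimately show ?thesis by (intro LIMSEQ_le_const2) auto
  qed
  ultimately obtain \<Phi> :: "'a cdual cdual" where
    \<Phi>: "norm \<Phi> \<le> 1" "\<And>w. Re (\<Phi> (h w)) = l w"
    by (rule hahn_banach_complex) blast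
  obtain x where "\<Phi> = bidual_embedding x"
    using refl by (auto simp: reflexive_space_def elim: surjE)
  then have eval: "\<Phi> f = f x" for f :: "'a cdual"
    by (simp add: bidual_embedding.rep_eq)
  \<comment> \<open>Comparing real parts suffices below, since a norming functional has the norm as
    the real part of its value.\<close>
  have hx: "Re (f (T x)) + Re (g (A x)) = Re (f y) + Re (g z)"
    for f :: "'b cdual" and g :: "'c cdual"
    using \<Phi>(2)[of "(f, g)"] by (simp add: eval h_apply l_def)
  show thesis
  proof
    \<comment> \<open>Testing \<open>\<Phi>\<close> on a functional that norms \<open>x\<close>
      bounds \<open>norm x\<close> by \<open>norm \<Phi>\<close>.\<close>
    obtain f :: "'a cdual" where f: "norm f \<le> 1" "Re (f x) = norm x"
      by (rule norming_functional)
    have "norm x \<le> cmod (\<Phi> f)"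
      using f(2) complex_Re_le_cmod[of "f x"] by (simp add: eval)
    also have "\<dots> \<le> norm \<Phi> * norm f" by (rule norm_cblinfun)
    also have "\<dots> \<le> 1" using f(1) \<Phi>(1) by (simp add: mult_le_one)
    finally show "norm x \<le> 1" .
    obtain f :: "'b cdual" where "Re (f (T x - y)) = norm (T x - y)"
      using norming_functional by blast
    then show "T x = y"
      using hx[of f 0]
      by (simp add: zero_cblinfun.rep_eq cblinfun_apply_diff)
    obtain g :: "'c cdual" where "Re (g (A x - z)) = norm (A x - z)"
      using norming_functional by blast
    then show "A x = z"
      using hx[of 0 g]
      by (simp add: zero_cblinfun.rep_eq cblinfun_apply_diff)
  qed
qed

section \<open>Almost norming vectors and convergent images\<close>

lemma norm_cblinfun_almost_attained:
  fixes T :: "'a :: complex_normed_vector \<Rightarrow>\<^sub>C\<^sub>L 'b :: complex_normed_vector"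
  assumes "b < norm T"
  obtains x where "norm x \<le> 1" "b < norm (T x)"
proof -
  have "\<exists>x. norm x \<le> 1 \<and> b < norm (T x)"
  proof (rule ccontr)
    assume "\<not> ?thesis"
    then have le: "norm (T x) \<le> b" if "norm x \<le> 1" for x
      using that by force
    \<comment> \<open>The bound at \<open>0\<close> gives the sign of \<open>b\<close>, as
      \<open>onorm_bound\<close> requires; scaling to the sphere then gives the bound at all other
      vectors.\<close>
    have "b \<ge> 0" using le[of 0] norm_ge_zero[of "T 0"] by (simp del: norm_ge_zero)
    moreover have "norm (T x) \<le> b * norm x" for x
    proof (cases "x = 0")
      case False
      then show ?thesis
        using le[of "inverse (norm x) *\<^sub>R x"]
        by (simp add: cblinfun_apply_scaleR
            field_simps)
    qed (simp add: cblinfun_apply_zero)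
    ultimately have "norm T \<le> b"
      unfolding norm_cblinfun.rep_eq by (intro onorm_bound)
    with assms show False by simp
  qed
  then show thesis using that by blast
qed

lemma compact_operator_convergent_subseq:
  assumes "T \<in> compact_operators" "\<And>n. norm (xs n) \<le> 1"
  obtains y and r :: "nat \<Rightarrow> nat" where "strict_mono r" "(\<lambda>n. T (xs (r n))) \<longlonglongrightarrow> y"
proof -
  have "seq_compact (closure (cblinfun_apply T ` cball 0 1))"
    using assms(1) by (simp add: compact_operators_def compact_imp_seq_compact)
  moreover have "\<forall>n. T (xs n) \<in> closure (cblinfun_apply T ` cball 0 1)"
    using assms(2) closure_subset by fastforce
  ultimately show thesis
    using that by (auto elim!: seq_compactE simp: o_def)
qed

section \<open>Orthogonality and the norm attainment set\<close>

definition right_orthogonal :: "complex \<Rightarrow> 'a :: complex_normed_vector \<Rightarrow> 'a \<Rightarrow> bool" where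
  "right_orthogonal \<gamma> x y \<longleftrightarrow> (\<forall>t\<ge>0. norm (x + (complex_of_real t * \<gamma>) *\<^sub>C y) \<ge> norm x)"

lemma bj_orthogonal_dir_iff_right:
  "bj_orthogonal_dir \<gamma> x y \<longleftrightarrow> right_orthogonal \<gamma> x y \<and> right_orthogonal (- \<gamma>) x y"
proof
  assume R: "right_orthogonal \<gamma> x y \<and> right_orthogonal (- \<gamma>) x y"
  have "norm (x + (complex_of_real t * \<gamma>) *\<^sub>C y) \<ge> norm x" for t
  proof (cases "t \<ge> 0")
    case False
    then have "norm (x + (complex_of_real (- t) * (- \<gamma>)) *\<^sub>C y) \<ge> norm x"
      using R by (auto simp only: right_orthogonal_def)
    then show ?thesis by simp
  qed (use R in \<open>simp add: right_orthogonal_def\<close>)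
  then show "bj_orthogonal_dir \<gamma> x y" by (simp add: bj_orthogonal_dir_def)
next
  assume R: "bj_orthogonal_dir \<gamma> x y"
  have "norm (x + (complex_of_real t * (- \<gamma>)) *\<^sub>C y) \<ge> norm x" for t
    using R[unfolded bj_orthogonal_dir_def, rule_format, of "- t"] by simp
  with R show "right_orthogonal \<gamma> x y \<and> right_orthogonal (- \<gamma>) x y"
    by (simp add: bj_orthogonal_dir_def right_orthogonal_def)
qed

section \<open>Convexity of the norm along a line\<close>

lemma norm_line_convex:
  fixes x y :: "'a :: real_normed_vector"
  assumes "0 \<le> s" "s \<le> 1"
  shows "norm (x + ((1 - s) * a + s * b) *\<^sub>R y) \<le> (1 - s) * norm (x + a *\<^sub>R y) + s * norm (x + b *\<^sub>R y)"
proof -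
  have "x + ((1 - s) * a + s * b) *\<^sub>R y = (1 - s) *\<^sub>R (x + a *\<^sub>R y) + s *\<^sub>R (x + b *\<^sub>R y)"
    by (simp add: algebra_simps)
  also have "norm \<dots> \<le> (1 - s) * norm (x + a *\<^sub>R y) + s * norm (x + b *\<^sub>R y)"
    using assms by (intro order_trans[OF norm_triangle_ineq]) simp
  finally show ?thesis .
qed

lemma scaleC_of_real_mult: "(complex_of_real t * \<gamma>) *\<^sub>C y = t *\<^sub>R \<gamma> *\<^sub>C y"
  by (simp add: scaleC_of_real[symmetric] scaleC_scaleC)

text \<open>If both failed, the norm would drop below \<open>norm x\<close> at points on either side
  of \<open>x\<close> on one real line, against convexity.\<close>

lemma right_orthogonal_cases: "right_orthogonal \<gamma> x y \<or> right_orthogonal (- \<gamma>) x y"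
proof (rule ccontr)
  assume "\<not> ?thesis"
  then obtain s t where st: "s \<ge> 0" "norm (x + (complex_of_real s * \<gamma>) *\<^sub>C y) < norm x"
    "t \<ge> 0" "norm (x + (complex_of_real t * (- \<gamma>)) *\<^sub>C y) < norm x"
    by (auto simp: right_orthogonal_def not_le)
  define u where "u = \<gamma> *\<^sub>C y"
  have s: "norm (x + s *\<^sub>R u) < norm x"
    using st(2) by (simp add: u_def scaleC_of_real_mult)
  have "(complex_of_real t * (- \<gamma>)) *\<^sub>C y = (- t) *\<^sub>R u"
    unfolding u_def scaleC_of_real_mult[symmetric] by simp
  then have t: "norm (x + (- t) *\<^sub>R u) < norm x"
    using st(4) by simp
  have "s \<noteq> 0" using s by auto
  with st have pos: "s + t > 0" by simp
  \<comment> \<open>The weight for which parameter \<open>0\<close> is the convex combination of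
    \<open>s\<close> and \<open>- t\<close>. It is positive, which keeps the estimate
    strict.\<close>
  define w where "w = s / (s + t)"
  have w: "0 < w" "w \<le> 1"
    using pos st(1,3) \<open>s \<noteq> 0\<close> by (simp_all add: w_def field_simps)
  have "(1 - w) * s + w * (- t) = 0"
    using pos by (simp add: w_def field_simps)
  then have "norm x \<le> (1 - w) * norm (x + s *\<^sub>R u) + w * norm (x + (- t) *\<^sub>R u)"
    using norm_line_convex[of w x s "- t" u] w by simp
  also have "\<dots> < (1 - w) * norm x + w * norm x"
    using w s t by (intro add_le_less_mono mult_left_mono mult_strict_left_mono) auto
  finally show False by (simp add: algebra_simps)
qed

section \<open>Norm attaining vectors as limits of almost attaining ones\<close>

lemma exists_right_orthogonal_attaining:
  fixes T A :: "'a :: complex_normed_vector \<Rightarrow>\<^sub>C\<^sub>L 'b :: complex_normed_vector"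
  assumes refl: "reflexive_space TYPE('a)"
    and T: "T \<in> compact_operators" and A: "A \<in> compact_operators" and "T \<noteq> 0"
    and orth: "right_orthogonal \<gamma> T A"
  obtains x where "x \<in> norm_attainment_set T" "right_orthogonal \<gamma> (T x) (A x)"
proof -
  \<comment> \<open>The step size is \<open>e n\<close> and the tolerance \<open>e n * e n\<close>:
    the tolerance must be negligible against the step, as it is divided by \<open>e m / t\<close>
    below.\<close>
  define e where "e n = inverse (real (Suc n))" for n
  have e: "0 < e n" for n by (simp add: e_def)
  have "\<exists>x. norm x \<le> 1 \<and> norm T - e n * e n < norm (T x + e n *\<^sub>R \<gamma> *\<^sub>C A x)" for n
  proof -
    have "norm T - e n * e n < norm (T + (complex_of_real (e n) * \<gamma>) *\<^sub>C A)"
      using orth e[of n] mult_pos_pos[OF e e, of n n] unfolding right_orthogonal_def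
      by (smt (verit))
    then obtain x where "norm x \<le> 1"
      "norm T - e n * e n < norm (cblinfun_apply (T + (complex_of_real (e n) * \<gamma>) *\<^sub>C A) x)"
      by (rule norm_cblinfun_almost_attained)
    then show ?thesis
      by (auto simp: plus_cblinfun.rep_eq scaleC_cblinfun.rep_eq scaleC_of_real_mult
          scaleR_cblinfun_apply)
  qed
  then have "\<exists>xs. \<forall>n. norm (xs n) \<le> 1 \<and>
      norm T - e n * e n < norm (T (xs n) + e n *\<^sub>R \<gamma> *\<^sub>C A (xs n))"
    by (intro choice allI)
  then obtain xs where xs: "\<And>n. norm (xs n) \<le> 1"
    and near: "\<And>n. norm T - e n * e n < norm (T (xs n) + e n *\<^sub>R \<gamma> *\<^sub>C A (xs n))"
    by blast
  obtain r y where r: "strict_mono r" "(\<lambda>n. T (xs (r n))) \<longlonglongrightarrow> y"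
    by (rule compact_operator_convergent_subseq[where xs = xs, OF T xs])
  \<comment> \<open>The second subsequence refines the first, so both images converge along
    \<open>k\<close>.\<close>
  obtain r' z where r': "strict_mono r'" "(\<lambda>n. A (xs (r (r' n)))) \<longlonglongrightarrow> z"
    by (rule compact_operator_convergent_subseq[where xs = "\<lambda>n. xs (r n)", OF A xs])
  define k where "k n = r (r' n)" for n
  have k: "strict_mono k"
    using strict_mono_o[OF r(1) r'(1)] by (simp add: k_def[abs_def] o_def)
  have lim: "(\<lambda>n. T (xs (k n))) \<longlonglongrightarrow> y" "(\<lambda>n. A (xs (k n))) \<longlonglongrightarrow> z"
    using LIMSEQ_subseq_LIMSEQ[OF r(2) r'(1)] r'(2) by (simp_all add: k_def[abs_def] o_def)
  obtain x where x: "norm x \<le> 1" "T x = y" "A x = z"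
    by (rule reflexive_limit_of_images[OF refl _ lim]) (rule xs)
  have e0: "(\<lambda>n. e (k n)) \<longlonglongrightarrow> 0"
    using LIMSEQ_subseq_LIMSEQ[OF LIMSEQ_inverse_real_of_nat k] by (simp add: e_def o_def)
  have limC: "(\<lambda>n. \<gamma> *\<^sub>C A (xs (k n))) \<longlonglongrightarrow> \<gamma> *\<^sub>C z"
    by (intro bounded_linear.tendsto[OF bounded_linear_scaleC_right] lim)
  have le_T: "norm (T v) \<le> norm T" if "norm v \<le> 1" for v
    using norm_cblinfun[of T v] that by (smt (verit) mult_left_le norm_ge_zero)
  \<comment> \<open>The perturbation and the tolerance both vanish in the limit.\<close>
  have "norm T \<le> norm y"
  proof (rule LIMSEQ_le)
    have "(\<lambda>n. norm T - e (k n) * e (k n)) \<longlonglongrightarrow> norm T - 0 * 0"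
      by (intro tendsto_intros e0)
    then show "(\<lambda>n. norm T - e (k n) * e (k n)) \<longlonglongrightarrow> norm T" by simp
    have "(\<lambda>n. norm (T (xs (k n)) + e (k n) *\<^sub>R \<gamma> *\<^sub>C A (xs (k n)))) \<longlonglongrightarrow> norm (y + 0 *\<^sub>R \<gamma> *\<^sub>C z)"
      by (intro tendsto_intros e0 lim limC)
    then show "(\<lambda>n. norm (T (xs (k n)) + e (k n) *\<^sub>R \<gamma> *\<^sub>C A (xs (k n)))) \<longlonglongrightarrow> norm y" by simp
  qed (use near in \<open>auto intro: less_imp_le\<close>)
  then have Tx: "norm (T x) = norm T"
    using x(2) le_T[OF x(1)] by simp
  have "norm x = 1"
  proof -
    have "norm T \<le> norm T * norm x" using norm_cblinfun[of T x] Tx by simp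
    then show ?thesis using \<open>T \<noteq> 0\<close> x(1) by simp
  qed
  then have "x \<in> norm_attainment_set T"
    using Tx by (simp add: norm_attainment_set_def)
  moreover have "right_orthogonal \<gamma> (T x) (A x)"
    unfolding right_orthogonal_def
  proof (intro allI impI)
    fix t :: real assume "t \<ge> 0"
    show "norm (T x) \<le> norm (T x + (complex_of_real t * \<gamma>) *\<^sub>C A x)"
    proof (cases "t = 0")
      case False
      with \<open>t \<ge> 0\<close> have t: "t > 0" by simp
      \<comment> \<open>Convexity carries the estimate from the small step \<open>e m\<close> to the
        fixed step \<open>t\<close>: the point at \<open>e m\<close> is a convex combination of
        those at \<open>0\<close> and \<open>t\<close>. Dividing by the weight
        \<open>s = e m / t\<close> leaves the error \<open>t * e m\<close>, which tends to
        \<open>0\<close> along \<open>k\<close>.\<close>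
      have "norm T - t * e m \<le> norm (T (xs m) + t *\<^sub>R \<gamma> *\<^sub>C A (xs m))"
        if "e m < t" for m
      proof -
        define s where "s = e m / t"
        have s: "0 < s" "s \<le> 1" "s * t = e m"
          using that t e[of m] by (simp_all add: s_def)
        have "norm T - e m * e m < (1 - s) * norm (T (xs m)) + s * norm (T (xs m) + t *\<^sub>R \<gamma> *\<^sub>C A (xs m))"
          using near[of m] norm_line_convex[of s "T (xs m)" 0 t "\<gamma> *\<^sub>C A (xs m)"] s by simp
        also have "\<dots> \<le> (1 - s) * norm T + s * norm (T (xs m) + t *\<^sub>R \<gamma> *\<^sub>C A (xs m))"
          using le_T[OF xs] s by (simp add: mult_left_mono)
        finally have "s * (norm T - t * e m) < s * norm (T (xs m) + t *\<^sub>R \<gamma> *\<^sub>C A (xs m))"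
          unfolding right_diff_distrib mult.assoc[symmetric] s(3) by (simp add: algebra_simps)
        then show ?thesis using s(1) by simp
      qed
      moreover have "\<forall>\<^sub>F n in sequentially. e (k n) < t"
        using order_tendstoD(2)[OF e0 t] .
      ultimately have ev: "\<forall>\<^sub>F n in sequentially.
          norm T - t * e (k n) \<le> norm (T (xs (k n)) + t *\<^sub>R \<gamma> *\<^sub>C A (xs (k n)))"
        by (auto elim: eventually_mono)
      have "norm T - t * 0 \<le> norm (y + t *\<^sub>R \<gamma> *\<^sub>C z)"
        by (rule tendsto_le[OF sequentially_bot _ _ ev]) (intro tendsto_intros e0 lim limC)+
      then show ?thesis
        using Tx x by (simp add: scaleC_of_real_mult)
    qed (use scaleC_of_real_mult[of 0 \<gamma> "A x"] in simp)
  qed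
  ultimately show thesis by (rule that)
qed

section \<open>Connectedness of the norm attainment set and the two implications\<close>

theorem theorem4p6:
  fixes T A :: "'a :: complex_banach \<Rightarrow>\<^sub>C\<^sub>L 'b :: complex_banach"
  assumes nontrivial: "(UNIV :: 'a set) \<noteq> {0}"
    and reflexive: "reflexive_space TYPE('a)"
    and "T \<in> compact_operators" and "A \<in> compact_operators"
    and "connected (norm_attainment_set T)"
  shows "T \<bottom>\<^sub>B A \<longleftrightarrow>
    (\<forall>\<gamma>\<in>sphere 0 1. \<exists>x\<in>norm_attainment_set T. bj_orthogonal_dir \<gamma> (T x) (A x))"
proof
  assume orth: "T \<bottom>\<^sub>B A"
  show "\<forall>\<gamma>\<in>sphere 0 1. \<exists>x\<in>norm_attainment_set T. bj_orthogonal_dir \<gamma> (T x) (A x)"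
  proof (intro ballI, cases "T = 0")
    case True
    \<comment> \<open>Every unit vector attains the norm of the zero operator, and
      \<open>nontrivial\<close> provides one.\<close>
    obtain v :: 'a where "v \<noteq> 0" using nontrivial by auto
    then have "sgn v \<in> norm_attainment_set T"
      by (simp add: True norm_attainment_set_def norm_sgn zero_cblinfun.rep_eq)
    then show "\<exists>x\<in>norm_attainment_set T. bj_orthogonal_dir \<gamma> (T x) (A x)" for \<gamma>
      by (auto simp: True zero_cblinfun.rep_eq bj_orthogonal_dir_def)
  next
    case False
    define P where "P \<gamma> = {x. right_orthogonal \<gamma> (T x) (A x)}" for \<gamma>
    have meets: "P \<gamma> \<inter> norm_attainment_set T \<noteq> {}" for \<gamma>
    proof -
      have "right_orthogonal \<gamma> T A"
        using orth by (simp add: bj_orthogonal_def right_orthogonal_def)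
      with reflexive assms(3,4) False obtain x
        where "x \<in> norm_attainment_set T" "right_orthogonal \<gamma> (T x) (A x)"
        by (rule exists_right_orthogonal_attaining)
      then show ?thesis by (auto simp: P_def)
    qed
    \<comment> \<open>For each fixed \<open>t\<close> the condition compares two continuous
      functions of \<open>x\<close>; \<open>P \<gamma>\<close> is the intersection over
      \<open>t \<ge> 0\<close>.\<close>
    have "closed (P \<gamma>)" for \<gamma>
      unfolding P_def right_orthogonal_def
      by (intro closed_Collect_all closed_Collect_imp closed_Collect_le open_Collect_const
          continuous_intros bounded_linear.continuous_on[OF bounded_linear_scaleC_right]
          bounded_linear.continuous_on[OF bounded_linear_cblinfun_apply])
    moreover have "norm_attainment_set T \<subseteq> P \<gamma> \<union> P (- \<gamma>)" for \<gamma>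
      using right_orthogonal_cases by (auto simp: P_def)
    ultimately have "P \<gamma> \<inter> P (- \<gamma>) \<inter> norm_attainment_set T \<noteq> {}" for \<gamma>
      using connected_closedD[OF assms(5), of "P \<gamma>" "P (- \<gamma>)"] meets[of \<gamma>] meets[of "- \<gamma>"]
      by metis
    then show "\<exists>x\<in>norm_attainment_set T. bj_orthogonal_dir \<gamma> (T x) (A x)" for \<gamma>
      by (fastforce simp: P_def bj_orthogonal_dir_iff_right)
  qed
next
  assume dir: "\<forall>\<gamma>\<in>sphere 0 1. \<exists>x\<in>norm_attainment_set T. bj_orthogonal_dir \<gamma> (T x) (A x)"
  show "T \<bottom>\<^sub>B A"
    unfolding bj_orthogonal_def
  proof
    fix c :: complex
    \<comment> \<open>Polar form of \<open>c\<close>; at \<open>c = 0\<close> the value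
      \<open>sgn 0 = 0\<close> is not unimodular, so \<open>1\<close> is taken.\<close>
    define \<gamma> where "\<gamma> = (if c = 0 then 1 else sgn c)"
    have c: "c = complex_of_real (cmod c) * \<gamma>" and "\<gamma> \<in> sphere 0 1"
      by (auto simp: \<gamma>_def sgn_eq norm_divide)
    then obtain x where x: "x \<in> norm_attainment_set T" "bj_orthogonal_dir \<gamma> (T x) (A x)"
      using dir by blast
    have "norm T = norm (T x)" using x(1) by (simp add: norm_attainment_set_def)
    also have "\<dots> \<le> norm (T x + c *\<^sub>C A x)"
      using x(2) c by (metis bj_orthogonal_dir_def)
    also have "\<dots> = norm (cblinfun_apply (T + c *\<^sub>C A) x)"
      by (simp add: plus_cblinfun.rep_eq scaleC_cblinfun.rep_eq)
    also have "\<dots> \<le> norm (T + c *\<^sub>C A) * norm x" by (rule norm_cblinfun)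
    also have "norm x = 1" using x(1) by (simp add: norm_attainment_set_def)
    finally show "norm T \<le> norm (T + c *\<^sub>C A)" by simp
  qed
qed

end
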